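(* Let $p$ be a prime, let $h$ be a non-negative integer and let $s$ be an integer such that $\gcd(s,15)=1$ if $p\in\{2,3\}$, and $s=1$ if $p=5$; put $q=p^{15h+s}$. Then the $3$-dimensional vector space $V(3,q^5)$ over $\mathbb{F}_{q^5}$ contains a scattered $\mathbb{F}_q$-subspace of $\mathbb{F}_q$-dimension $7$.
   Context: $V(r,q^n)$ denotes an $r$-dimensional vector space over the finite field $\mathbb{F}_{q^n}$; it is also an $rn$-dimensional vector space over $\mathbb{F}_q$. An $\mathbb{F}_q$-subspace $U$ of $V(r,q^n)$ is called scattered if $U\neq\{0\}$ and every $1$-dimensional $\mathbb{F}_{q^n}$-subspace of $V(r,q^n)$ meets $U$ in an $\mathbb{F}_q$-subspace of $\mathbb{F}_q$-dimension at most $1$. *)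

theory Defs
  imports Complex_Main "HOL-Computational_Algebra.Primes"
begin

text \<open>
  The extension of finite fields is given by two types \<open>'f\<close> and \<open>'k\<close> and an
  embedding of \<open>'f\<close> into \<open>'k\<close>. A \<open>'k\<close>-vector space is then also an \<open>'f\<close>-vector space by
  restriction of scalars, so that the library's subspaces and dimensions are available over
  both fields. For finite fields of given orders, the image of the embedding does not depend on
  the embedding: it is the unique subfield of its order.
\<close>

definition field_embedding :: "('f::field \<Rightarrow> 'k::field) \<Rightarrow> bool" where
  "field_embedding \<iota> \<longleftrightarrow>
     \<iota> 1 = 1 \<and> (\<forall>x y. \<iota> (x + y) = \<iota> x + \<iota> y) \<and> (\<forall>x y. \<iota> (x * y) = \<iota> x * \<iota> y)"

definition restrict_scalars :: "('f::field \<Rightarrow> 'k::field) \<Rightarrow> ('k \<Rightarrow> 'v \<Rightarrow> 'v) \<Rightarrow> 'f \<Rightarrow> 'v \<Rightarrow> 'v" where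
  "restrict_scalars \<iota> scale = (\<lambda>a. scale (\<iota> a))"

lemma vector_space_restrict_scalars:
  assumes "field_embedding \<iota>" and "vector_space scale"
  shows "vector_space (restrict_scalars \<iota> scale)"
proof -
  interpret vector_space scale by fact
  show ?thesis
    using assms(1) unfolding field_embedding_def restrict_scalars_def
    by unfold_locales (auto simp: scale_right_distrib scale_left_distrib)
qed

definition scattered ::
  "('f::field \<Rightarrow> 'k::field) \<Rightarrow> ('k \<Rightarrow> 'v::ab_group_add \<Rightarrow> 'v) \<Rightarrow> 'v set \<Rightarrow> bool" where
  "scattered \<iota> scale U \<longleftrightarrow>
     module.subspace (restrict_scalars \<iota> scale) U \<and> U \<noteq> {0} \<and>
     (\<forall>W. module.subspace scale W \<and> vector_space.dim scale W = 1 \<longrightarrow>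
          vector_space.dim (restrict_scalars \<iota> scale) (U \<inter> W) \<le> 1)"

end

theory Submission
  imports Defs "HOL-Algebra.Algebraic_Closure_Type"
begin

text \<open>
  Let \<open>\<psi>\<close> generate the Galois group of \<open>K = F\<^bsub>q^5\<^esub>\<close> over \<open>F\<^bsub>q\<^esub>\<close>; as the exponent of \<open>q = p^m\<close> is prime
  to 5, \<open>\<psi>\<close> can be chosen to act on \<open>F\<^bsub>p^5\<^esub>\<close> as the Frobenius map. The subspace is
  \<open>U = {(x, \<psi> x + a, r \<psi>\<^sup>4 x + s a + b) | x \<in> K; a, b \<in> F\<^bsub>q\<^esub>}\<close> with suitable \<open>r, s \<in> F\<^bsub>p^5\<^esub>\<close>.

  If \<open>u\<close> and \<open>\<lambda> u\<close> both lie in \<open>U\<close> with \<open>\<lambda> \<notin> F\<^bsub>q\<^esub>\<close>, then in the \<open>F\<^bsub>q\<^esub>\<close>-span of \<open>u\<close> and \<open>\<lambda> u\<close> one may pick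
  \<open>u\<close> with \<open>a = 0\<close>, which determines \<open>x\<close> from \<open>\<lambda>\<close> up to a factor in \<open>F\<^bsub>q\<^esub>\<close>. Writing \<open>\<lambda>\<^sub>i = \<psi>\<^sup>i \<lambda>\<close>, what
  remains is \<open>(b \<lambda>\<^sub>0 - c - s) (\<lambda>\<^sub>3 - \<lambda>\<^sub>4) = r (\<lambda>\<^sub>4 - \<lambda>\<^sub>0)\<close> with \<open>b, c \<in> F\<^bsub>q\<^esub>\<close>, and \<open>r, s\<close> have to be chosen such
  that this has no solution. For \<open>b = 0\<close>, two polynomials over \<open>F\<^bsub>p^5\<^esub>\<close> would vanish at \<open>- c\<close>, but they
  are coprime. For \<open>b \<noteq> 0\<close>, replacing \<open>\<lambda>\<close> by \<open>b \<lambda> - c\<close> leads to a cyclic system of five equations in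
  the \<open>\<lambda>\<^sub>i\<close>. Eliminating all unknowns but \<open>\<lambda>\<^sub>0\<close> gives a polynomial over \<open>F\<^bsub>p^5\<^esub>\<close> that is the product of
  two linear factors, whose roots do not solve the system, and two cubics that are irreducible over
  \<open>F\<^bsub>p^5\<^esub>\<close>. A root of such a cubic generates a field containing \<open>F\<^bsub>p^3\<^esub>\<close>, which is not contained in \<open>K\<close>
  since 3 does not divide \<open>5 m\<close>.
\<close>

text \<open>Otherwise the primality predicate of HOL-Algebra shadows the one of the theorem.\<close>
hide_const (open) Divisibility.prime

section \<open>Finite fields\<close>

text \<open>Multiplication by a nonzero \<open>x\<close> permutes the nonzero elements, so it leaves
  their product unchanged.\<close>

lemma power_card_eq_self:
  fixes x :: "'a::{field,finite}"
  shows "x ^ card (UNIV :: 'a set) = x"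
proof (cases "x = 0")
  case True
  then show ?thesis
    by (simp add: zero_power finite_UNIV_card_ge_0)
next
  case False
  let ?U = "UNIV - {0 :: 'a}"
  have "bij_betw ((*) x) ?U ?U"
    using False by (intro bij_betwI[where g = "\<lambda>y. y / x"]) auto
  then have "(\<Prod>y\<in>?U. x * y) = \<Prod>?U"
    by (rule prod.reindex_bij_betw)
  then have "x ^ card ?U * \<Prod>?U = \<Prod>?U"
    by (simp add: prod.distrib)
  moreover have "\<Prod>?U \<noteq> 0"
    by simp
  ultimately have "x ^ card ?U = 1"
    by (metis mult_cancel_right1)
  moreover have "card (UNIV :: 'a set) = Suc (card ?U)"
    using card_Suc_Diff1[of UNIV "0 :: 'a"] by simp
  ultimately show ?thesis
    by (metis mult.right_neutral power_Suc)
qed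

text \<open>Translation by 1 permutes the field, so it leaves the sum of all elements
  unchanged.\<close>

lemma of_nat_card_eq_0: "of_nat (card (UNIV :: 'a::{field,finite} set)) = (0 :: 'a)"
proof -
  have "bij_betw (\<lambda>x. x + 1) (UNIV :: 'a set) UNIV"
    by (intro bij_betwI[where g = "\<lambda>y. y - 1"]) auto
  then have "(\<Sum>x\<in>(UNIV :: 'a set). x) = (\<Sum>x\<in>UNIV. x + 1)"
    using sum.reindex_bij_betw[of "\<lambda>x. x + 1" UNIV UNIV "\<lambda>x :: 'a. x"] by simp
  then show ?thesis
    by (simp add: sum.distrib)
qed

lemma CHAR_eq_prime:
  assumes "prime p" and "card (UNIV :: 'a::{field,finite} set) = p ^ n"
  shows "CHAR('a) = p"
proof -
  have "of_nat p ^ n = (0 :: 'a)"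
    using of_nat_card_eq_0[where ?'a = 'a] unfolding assms(2) by simp
  then have "of_nat p = (0 :: 'a)"
    by simp
  then have "CHAR('a) dvd p"
    by (simp add: of_nat_eq_0_iff_char_dvd)
  then show ?thesis
    using assms(1) by (metis CHAR_not_1' One_nat_def prime_nat_iff)
qed

lemma power_prime_power_iterate:
  fixes x :: "'a::monoid_mult"
  assumes "x ^ (p ^ a) = x"
  shows "x ^ (p ^ (a * n)) = x"
  by (induction n) (simp_all add: power_add power_mult assms)

text \<open>Raising to the power \<open>p ^ (b * k)\<close> fixes \<open>x\<close>, so the exponent
  \<open>gcd a b\<close> of \<open>p\<close> may be replaced by \<open>b * k + gcd a b\<close>,
  which Bezout makes a multiple of \<open>a\<close>.\<close>

lemma power_prime_power_gcd:
  fixes x :: "'a::monoid_mult"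
  assumes a: "x ^ (p ^ a) = x" and b: "x ^ (p ^ b) = x"
  shows "x ^ (p ^ gcd a b) = x"
proof (cases "a = 0")
  case True
  then show ?thesis using b by simp
next
  case False
  then obtain n k where nk: "a * n = b * k + gcd a b"
    using bezout_nat by blast
  have "x ^ (p ^ gcd a b) = (x ^ (p ^ (b * k))) ^ (p ^ gcd a b)"
    by (simp add: power_prime_power_iterate b)
  also have "\<dots> = x ^ (p ^ (a * n))"
    by (simp add: nk power_add power_mult)
  finally show ?thesis
    by (simp add: power_prime_power_iterate a)
qed

lemma card_power_eq_self_le:
  assumes "n > 1"
  shows "finite {x :: 'a::field. x ^ n = x}" "card {x :: 'a::field. x ^ n = x} \<le> n"
proof -
  let ?P = "Polynomial.monom 1 n - [:0, 1 :: 'a:]"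
  have "Polynomial.coeff (Polynomial.monom 1 n - [:0, 1 :: 'a:]) n = 1"
    using assms by (auto simp: coeff_pCons split: nat.splits)
  then have P: "?P \<noteq> 0"
    by (metis coeff_0 zero_neq_one)
  have deg: "Polynomial.degree ?P \<le> n"
    using assms by (intro degree_diff_le) (auto simp: degree_monom_eq)
  have eq: "{x. poly ?P x = 0} = {x. x ^ n = x}"
    by (auto simp: poly_monom)
  show "finite {x :: 'a. x ^ n = x}"
    using poly_roots_finite[OF P] by (simp only: eq)
  show "card {x :: 'a. x ^ n = x} \<le> n"
    using card_poly_roots_bound[OF P] deg by (simp only: eq)
qed

text \<open>The image consists of roots of X^q - X, where q is the order of \<open>'a\<close>, and
  there are at most q such roots. This recognises the images of both \<open>to_ac\<close> and
  \<open>\<iota>\<close> by a power equation.\<close>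

lemma range_eq_power_fixed:
  fixes h :: "'a::{field,finite} \<Rightarrow> 'b::field"
  assumes inj: "inj h" and pow: "\<And>x n. h (x ^ n) = h x ^ n"
  shows "range h = {x. x ^ card (UNIV :: 'a set) = x}"
proof (rule card_subset_eq)
  have gt: "card (UNIV :: 'a set) > 1"
    using card_mono[of UNIV "{0, 1 :: 'a}"] by simp
  show "finite {x :: 'b. x ^ card (UNIV :: 'a set) = x}"
    by (rule card_power_eq_self_le[OF gt])
  show sub: "range h \<subseteq> {x. x ^ card (UNIV :: 'a set) = x}"
    by (auto simp: power_card_eq_self simp flip: pow)
  have "card (range h) = card (UNIV :: 'a set)"
    using inj by (simp add: card_image)
  moreover have "card {x :: 'b. x ^ card (UNIV :: 'a set) = x} \<le> card (UNIV :: 'a set)"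
    by (rule card_power_eq_self_le[OF gt])
  ultimately show "card (range h) = card {x :: 'b. x ^ card (UNIV :: 'a set) = x}"
    using card_mono[OF card_power_eq_self_le(1)[OF gt] sub] by simp
qed

lemma alg_closure_power_fixed:
  fixes x :: "'a::{field,finite} alg_closure"
  assumes "x ^ card (UNIV :: 'a set) = x"
  obtains y where "x = to_ac y"
proof -
  have "range (to_ac :: 'a \<Rightarrow> _) = {x. x ^ card (UNIV :: 'a set) = x}"
    by (rule range_eq_power_fixed) (auto simp: inj_to_ac)
  with assms that show thesis
    by blast
qed

text \<open>The fields of orders p^3 and p^n meet in the field of order p, because 3 and
  \<open>n\<close> are coprime.\<close>

lemma frobenius_fixed_of_cube:
  fixes t :: "'a::{field,finite}"
  assumes p: "prime p" and card: "card (UNIV :: 'a set) = p ^ n" and n: "\<not> 3 dvd n"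
    and t3: "t ^ (p ^ 3) = t"
  shows "t ^ p = t"
proof -
  have "coprime 3 n"
    using n by (intro prime_imp_coprime) simp_all
  then have "gcd 3 n = 1"
    by (rule coprime_imp_gcd_eq_1)
  then show ?thesis
    using power_prime_power_gcd[OF t3, of n] power_card_eq_self[of t] card by simp
qed

section \<open>Cubics without roots in characteristic 2, 3 and 5\<close>

lemma no_root_2:
  fixes t :: "'a::{field,finite}"
  assumes card: "card (UNIV :: 'a set) = 2 ^ n" and n: "\<not> 3 dvd n"
  shows "t ^ 3 + t + 1 \<noteq> 0"
proof
  assume t: "t ^ 3 + t + 1 = 0"
  have "CHAR('a) = 2"
    by (rule CHAR_eq_prime[OF _ card]) simp
  then have z: "(2 :: 'a) = 0"
    using of_nat_CHAR[where ?'a = 'a] by simp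
  \<comment> \<open>Division by the cubic over the integers; the remainder differs from
    \<open>t\<close> by a multiple of 2.\<close>
  have "t ^ 8 = (t ^ 3 + t + 1) * (t ^ 5 - t ^ 3 - t ^ 2 + t + 2) + t + 2 * (- 2 * t - 1)"
    by Groebner_Basis.algebra
  then have "t ^ (2 ^ 3) = t"
    by (simp add: t z)
  then have "t ^ 2 = t"
    using frobenius_fixed_of_cube[of 2 n t] card n by simp
  moreover have "t ^ 3 + t + 1 = (t ^ 2 - t) * (t + 1) + 2 * t + 1"
    by Groebner_Basis.algebra
  ultimately show False
    by (simp add: t z)
qed

lemma no_root_3:
  fixes t :: "'a::{field,finite}"
  assumes card: "card (UNIV :: 'a set) = 3 ^ n" and n: "\<not> 3 dvd n"
  shows "t ^ 3 + 2 * t + 2 \<noteq> 0"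
proof
  assume t: "t ^ 3 + 2 * t + 2 = 0"
  have "CHAR('a) = 3"
    by (rule CHAR_eq_prime[OF _ card]) simp
  then have z: "(3 :: 'a) = 0"
    using of_nat_CHAR[where ?'a = 'a] by simp
  \<comment> \<open>Modulo 3 the cubic is the Artin-Schreier polynomial t^3 - t - 1, so cubing
    shifts \<open>t\<close> by 1 and three cubings return to \<open>t\<close>.\<close>
  have "t ^ 3 = (t ^ 3 + 2 * t + 2) + t + 1 - 3 * (t + 1)"
    by Groebner_Basis.algebra
  then have 3: "t ^ 3 = t + 1"
    by (simp only: t z) simp
  have "(t + 1) ^ 3 = t ^ 3 + 1 + 3 * (t ^ 2 + t)"
    by Groebner_Basis.algebra
  then have 9: "(t + 1) ^ 3 = t + 2"
    by (simp add: 3 z)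
  have "(t + 2) ^ 3 = t ^ 3 + 3 * (2 * t ^ 2 + 4 * t + 3) - 1"
    by Groebner_Basis.algebra
  then have 27: "(t + 2) ^ 3 = t"
    by (simp add: 3 z)
  have "t ^ (3 ^ 3) = ((t ^ 3) ^ 3) ^ 3"
    by (simp flip: power_mult)
  also have "\<dots> = t"
    by (simp only: 3 9 27)
  finally have "t ^ 3 = t"
    using frobenius_fixed_of_cube[of 3 n t] card n by simp
  with 3 show False by simp
qed

lemma no_root_5:
  fixes t :: "'a::{field,finite}"
  assumes card: "card (UNIV :: 'a set) = 5 ^ n" and n: "\<not> 3 dvd n"
  shows "t ^ 3 + t + 1 \<noteq> 0"
proof
  assume t: "t ^ 3 + t + 1 = 0"
  have "CHAR('a) = 5"
    by (rule CHAR_eq_prime[OF _ card]) simp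
  then have z: "(5 :: 'a) = 0"
    using of_nat_CHAR[where ?'a = 'a] by simp
  have 5: "t ^ 5 = 1 + t - t ^ 2"
    using t by Groebner_Basis.algebra
  \<comment> \<open>\<open>s\<close> and \<open>r\<close> are the conjugates t^5 and t^25. Each is
    again a root of the cubic, so the same reduction of the fifth power applies to it.\<close>
  define s where "s = 1 + t - t ^ 2"
  have s: "s ^ 3 + s + 1 = 0"
  proof -
    have "s ^ 3 + s + 1 = (t ^ 3 + t + 1) * (- 7 + t + 3 * t ^ 2 - t ^ 3) + 5 * (2 + 2 * t - t ^ 2)"
      unfolding s_def by Groebner_Basis.algebra
    then show ?thesis
      by (simp only: t z) simp
  qed
  have 25: "s ^ 5 = 1 + s - s ^ 2"
    using s by Groebner_Basis.algebra
  define r where "r = 1 + s - s ^ 2"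
  have r: "r ^ 3 + r + 1 = 0"
  proof -
    have "r ^ 3 + r + 1 = (s ^ 3 + s + 1) * (- 7 + s + 3 * s ^ 2 - s ^ 3) + 5 * (2 + 2 * s - s ^ 2)"
      unfolding r_def by Groebner_Basis.algebra
    then show ?thesis
      by (simp only: s z) simp
  qed
  have 125: "r ^ 5 = 1 + r - r ^ 2"
    using r by Groebner_Basis.algebra
  have "1 + r - r ^ 2 = t"
  proof -
    have "1 + r - r ^ 2 = (t ^ 3 + t + 1) * (6 + 4 * t - 5 * t ^ 2 - 3 * t ^ 3 + 4 * t ^ 4 - t ^ 5)
        + t + 5 * (- 1 - 2 * t)"
      unfolding r_def s_def by Groebner_Basis.algebra
    then show ?thesis
      by (simp only: t z) simp
  qed
  then have "((t ^ 5) ^ 5) ^ 5 = t"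
    using 5 25 125 by (simp flip: s_def r_def)
  then have "t ^ (5 ^ 3) = t"
    by (simp flip: power_mult)
  then have "t ^ 5 = t"
    using frobenius_fixed_of_cube[of 5 n t] card n by simp
  \<comment> \<open>A root in the prime field would satisfy t^2 = 1 and 2 t = -1, hence 4 = 1, which
    is impossible in characteristic 5.\<close>
  with 5 have "t ^ 2 = 1"
    by simp
  moreover have "t ^ 3 + t + 1 = (t ^ 2 - 1) * t + 2 * t + 1"
    by Groebner_Basis.algebra
  ultimately have "2 * t = - 1"
    using t by (simp add: eq_neg_iff_add_eq_0)
  moreover have "4 * t ^ 2 = (2 * t) ^ 2"
    by Groebner_Basis.algebra
  ultimately have "(4 :: 'a) = 1"
    using \<open>t ^ 2 = 1\<close> by simp
  moreover have "(1 :: 'a) = 2 * (4 - 1) - 5"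
    by simp
  ultimately have "(1 :: 'a) = 0"
    by (metis z diff_self mult_zero_right)
  then show False
    by simp
qed

section \<open>A scattered subspace of dimension 7\<close>

locale order5_aut =
  fixes \<psi> :: "'k::field \<Rightarrow> 'k"
  assumes add: "\<psi> (x + y) = \<psi> x + \<psi> y"
    and mult: "\<psi> (x * y) = \<psi> x * \<psi> y"
    and order5: "\<psi> (\<psi> (\<psi> (\<psi> (\<psi> x)))) = x"
begin

lemma zero [simp]: "\<psi> 0 = 0"
  by (metis add add.right_neutral add_left_cancel)

lemma minus: "\<psi> (- x) = - \<psi> x"
  using add[of x "- x"] by (simp add: eq_neg_iff_add_eq_0 add.commute)

lemma diff: "\<psi> (x - y) = \<psi> x - \<psi> y"
  using add[of x "- y"] by (simp add: minus)

lemma eq_iff [simp]: "\<psi> x = \<psi> y \<longleftrightarrow> x = y"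
  by (metis order5)

lemma eq_0_iff [simp]: "\<psi> x = 0 \<longleftrightarrow> x = 0"
  using eq_iff[of x 0] by simp

lemma one [simp]: "\<psi> 1 = 1"
  using mult[of 1 1] by simp

lemma inverse: "\<psi> (inverse x) = inverse (\<psi> x)"
proof (cases "x = 0")
  case False
  then have "\<psi> x * \<psi> (inverse x) = 1"
    by (simp flip: mult)
  then show ?thesis
    using inverse_unique by metis
qed simp

lemma divide: "\<psi> (x / y) = \<psi> x / \<psi> y"
  by (simp add: divide_inverse mult inverse)

lemma power: "\<psi> (x ^ n) = \<psi> x ^ n"
  by (induction n) (simp_all add: mult)

lemmas hom = add diff minus mult inverse divide power

end

locale scattered_coeffs = order5_aut \<psi> for \<psi> :: "'k::field \<Rightarrow> 'k" +
  fixes r s :: 'k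
  assumes no_solution: "\<psi> x \<noteq> x \<Longrightarrow> \<psi> b = b \<Longrightarrow> \<psi> c = c \<Longrightarrow>
    (b * x - c - s) * (\<psi> (\<psi> (\<psi> x)) - \<psi> (\<psi> (\<psi> (\<psi> x)))) \<noteq> r * (\<psi> (\<psi> (\<psi> (\<psi> x))) - x)"
begin

text \<open>Here \<open>l\<close> maps the vector with parameters \<open>(x, 0, b)\<close> to the
  one with parameters \<open>(l * x, A, B)\<close>. If \<open>l\<close> were not fixed, the first
  equation would express \<open>\<psi> x\<close> through \<open>l\<close> and \<open>A\<close>; its
  conjugate, substituted into the second equation, yields what \<open>no_solution\<close>
  excludes.\<close>

lemma fixed_multiplier_aux:
  assumes fixed: "\<psi> b = b" "\<psi> A = A" "\<psi> B = B"
    and nz: "x \<noteq> 0 \<or> b \<noteq> 0"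
    and 1: "l * \<psi> x = \<psi> (l * x) + A"
    and 2: "l * (r * \<psi> (\<psi> (\<psi> (\<psi> x))) + b) = r * \<psi> (\<psi> (\<psi> (\<psi> (l * x)))) + s * A + B"
  shows "\<psi> l = l"
proof (rule ccontr)
  assume l: "\<psi> l \<noteq> l"
  have A: "(l - \<psi> l) * \<psi> x = A"
    using 1 by (simp add: hom algebra_simps)
  show False
  proof (cases "A = 0")
    case True
    with A l have x: "x = 0"
      by simp
    with 2 True nz have "l = B / b"
      by (simp add: field_simps)
    with l show False
      by (simp add: hom fixed)
  next
    case False
    let ?l3 = "\<psi> (\<psi> (\<psi> l))" and ?l4 = "\<psi> (\<psi> (\<psi> (\<psi> l)))" and ?x4 = "\<psi> (\<psi> (\<psi> (\<psi> x)))"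
    have "\<psi> (\<psi> (\<psi> ((l - \<psi> l) * \<psi> x))) = A"
      by (simp add: A fixed)
    then have A4: "(?l3 - ?l4) * ?x4 = A"
      by (simp add: hom)
    have "r * (l - ?l4) * ?x4 = s * A + B - l * b"
      using 2 by (simp add: hom algebra_simps)
    then have "r * (l - ?l4) * A = (s * A + B - l * b) * (?l3 - ?l4)"
      unfolding A4[symmetric] by Groebner_Basis.algebra
    then have "(b / A * l - B / A - s) * (?l3 - ?l4) = r * (?l4 - l)"
      using False by (simp add: field_simps)
    with no_solution[OF l, of "b / A" "B / A"] show False
      by (simp add: hom fixed)
  qed
qed

lemma fixed_multiplier:
  assumes fixed: "\<psi> a = a" "\<psi> b = b" "\<psi> A = A" "\<psi> B = B"
    and nz: "x \<noteq> 0 \<or> a \<noteq> 0 \<or> b \<noteq> 0"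
    and 1: "l * (\<psi> x + a) = \<psi> (l * x) + A"
    and 2: "l * (r * \<psi> (\<psi> (\<psi> (\<psi> x))) + s * a + b)
      = r * \<psi> (\<psi> (\<psi> (\<psi> (l * x)))) + s * A + B"
  shows "\<psi> l = l"
proof (cases "a = 0")
  case True
  then show ?thesis
    using fixed_multiplier_aux[of b A B x l] assms by simp
next
  case a: False
  define k where "k = A / a"
  \<comment> \<open>Subtracting \<open>k\<close> times the vector from its image under
    \<open>l\<close> removes the parameter \<open>A\<close>.\<close>
  define m where "m = l - k"
  have k: "\<psi> k = k" "A = k * a"
    using a by (simp_all add: k_def hom fixed)
  show ?thesis
  proof (cases "m = 0")
    case True
    then show ?thesis
      using k by (simp add: m_def)
  next
    case m: False
    have m1: "m * (\<psi> x + a) = \<psi> (m * x)"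
      using 1 by (simp add: m_def hom k algebra_simps)
    have m2: "m * (r * \<psi> (\<psi> (\<psi> (\<psi> x))) + s * a + b)
        = r * \<psi> (\<psi> (\<psi> (\<psi> (m * x)))) + (B - k * b)"
      using 2 by (simp add: m_def hom k algebra_simps)
    have x: "x \<noteq> 0"
      using m1 a m by auto
    \<comment> \<open>The roles are exchanged: \<open>1 / m\<close> maps the vector with parameters
      \<open>(m * x, 0, B - k * b)\<close> to the one with parameters
      \<open>(x, a, b)\<close>.\<close>
    have "\<psi> (1 / m) = 1 / m"
    proof (rule fixed_multiplier_aux)
      show "1 / m * \<psi> (m * x) = \<psi> (1 / m * (m * x)) + a"
        using m by (simp flip: m1)
      show "1 / m * (r * \<psi> (\<psi> (\<psi> (\<psi> (m * x)))) + (B - k * b))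
          = r * \<psi> (\<psi> (\<psi> (\<psi> (1 / m * (m * x))))) + s * a + b"
        using m by (simp flip: m2)
    qed (use x m in \<open>simp_all add: hom fixed k\<close>)
    then have "\<psi> m = m"
      by (simp add: hom)
    then show ?thesis
      by (simp add: m_def hom k)
  qed
qed

end

section \<open>Counting dimensions and constructing the subspace\<close>

text \<open>Coordinates identify \<open>U\<close> with the functions from a basis to the field. This
  lets the dimension of the scattered subspace be found by counting.\<close>

lemma (in vector_space) card_eq_power_dim:
  assumes "finite (UNIV :: 'a set)" and "subspace U" and "finite U"
  shows "card U = card (UNIV :: 'a set) ^ dim U"
proof -
  obtain B where B: "B \<subseteq> U" "independent B" "U \<subseteq> span B" "card B = dim U"
    using basis_exists by blast
  have fin: "finite B"
    using B(1) assms(3) finite_subset by blast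
  have U: "U = span B"
    using B(1,3) assms(2) span_minimal by blast
  let ?h = "\<lambda>u. \<Sum>v\<in>B. u v *s v"
  have "bij_betw ?h (B \<rightarrow>\<^sub>E UNIV) (span B)"
    unfolding bij_betw_def
  proof
    show "inj_on ?h (B \<rightarrow>\<^sub>E UNIV)"
    proof (rule inj_onI)
      fix u w assume uw: "u \<in> B \<rightarrow>\<^sub>E UNIV" "w \<in> B \<rightarrow>\<^sub>E UNIV" and eq: "?h u = ?h w"
      have "(\<Sum>v\<in>B. (u v - w v) *s v) = 0"
        using eq by (simp add: scale_left_diff_distrib sum_subtractf)
      then have "u v - w v = 0" if "v \<in> B" for v
        using independentD[OF B(2) fin, of "\<lambda>v. u v - w v" v] that by simp
      then show "u = w"
        by (intro PiE_ext[OF uw]) simp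
    qed
    show "?h ` (B \<rightarrow>\<^sub>E UNIV) = span B"
    proof
      show "?h ` (B \<rightarrow>\<^sub>E UNIV) \<subseteq> span B"
        unfolding span_finite[OF fin] by blast
      show "span B \<subseteq> ?h ` (B \<rightarrow>\<^sub>E UNIV)"
      proof
        fix x assume "x \<in> span B"
        then obtain u where "x = ?h u"
          unfolding span_finite[OF fin] by blast
        then have "x = ?h (restrict u B)"
          by simp
        then show "x \<in> ?h ` (B \<rightarrow>\<^sub>E UNIV)"
          by (rule image_eqI[where x = "restrict u B"]) simp
      qed
    qed
  qed
  then have "card (span B) = card (B \<rightarrow>\<^sub>E (UNIV :: 'a set))"
    by (simp add: bij_betw_same_card)
  also have "\<dots> = card (UNIV :: 'a set) ^ card B"
    using fin by (simp add: card_PiE)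
  finally show ?thesis
    using U B(4) by simp
qed

lemma (in vector_space) dim_3_coordinates:
  assumes "dim UNIV = 3"
  obtains v1 v2 v3 where
    "\<And>x y z. x *s v1 + y *s v2 + z *s v3 = 0 \<Longrightarrow> x = 0 \<and> y = 0 \<and> z = 0"
proof -
  obtain B where B: "independent B" "card B = 3"
    using basis_exists[of UNIV] assms by auto
  then obtain v1 v2 v3 where v: "B = {v1, v2, v3}" "v1 \<noteq> v2" "v1 \<noteq> v3" "v2 \<noteq> v3"
    by (auto simp: card_3_iff)
  show thesis
  proof (rule that)
    fix x y z assume "x *s v1 + y *s v2 + z *s v3 = 0"
    then have sum0: "(\<Sum>v\<in>B. (if v = v1 then x else if v = v2 then y else z) *s v) = 0"
      using v by (simp add: add.assoc)
    have "(if v = v1 then x else if v = v2 then y else z) = 0" if "v \<in> B" for v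
      using independentD[OF B(1) _ subset_refl sum0 that] v(1) by simp
    from this[of v1] this[of v2] this[of v3] show "x = 0 \<and> y = 0 \<and> z = 0"
      using v by auto
  qed
qed

lemma inj_field_embedding:
  assumes "field_embedding \<iota>"
  shows "inj \<iota>"
proof (rule injI)
  have hom: "\<iota> 1 = 1" "\<And>x y. \<iota> (x + y) = \<iota> x + \<iota> y" "\<And>x y. \<iota> (x * y) = \<iota> x * \<iota> y"
    using assms by (auto simp: field_embedding_def)
  fix x y assume "\<iota> x = \<iota> y"
  then have "\<iota> (x - y) = 0"
    using hom(2)[of "x - y" y] by simp
  then show "x = y"
    using hom(3)[of "x - y" "inverse (x - y)"] hom(1) by (cases "x = y") auto
qed

lemma ex_scattered_dim_7:
  fixes \<iota> :: "'f::{field,finite} \<Rightarrow> 'k::{field,finite}"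
    and scale :: "'k \<Rightarrow> 'v::ab_group_add \<Rightarrow> 'v"
  assumes emb: "field_embedding \<iota>" and vs: "vector_space scale"
    and dim3: "vector_space.dim scale UNIV = 3"
    and card: "card (UNIV :: 'k set) = card (UNIV :: 'f set) ^ 5"
    and range: "range \<iota> = {x. \<psi> x = x}"
    and coeffs: "scattered_coeffs \<psi> r s"
  shows "\<exists>U. scattered \<iota> scale U \<and> vector_space.dim (restrict_scalars \<iota> scale) U = 7"
proof -
  interpret K: vector_space scale by (rule vs)
  let ?F = "restrict_scalars \<iota> scale"
  interpret F: vector_space ?F by (rule vector_space_restrict_scalars[OF emb vs])
  interpret scattered_coeffs \<psi> r s by (rule coeffs)
  have scale_F: "?F a v = scale (\<iota> a) v" for a v
    by (simp add: restrict_scalars_def)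
  have fixed_\<iota>: "\<psi> (\<iota> a) = \<iota> a" for a
    using range by blast
  have inj_\<iota>: "inj \<iota>"
    by (rule inj_field_embedding[OF emb])
  have card_fixed: "card {x. \<psi> x = x} = card (UNIV :: 'f set)"
    using inj_\<iota> by (simp add: card_image flip: range)
  obtain v1 v2 v3 where indep:
    "\<And>x y z. scale x v1 + scale y v2 + scale z v3 = 0 \<Longrightarrow> x = 0 \<and> y = 0 \<and> z = 0"
    using K.dim_3_coordinates[OF dim3] by blast
  define comb where "comb x y z = scale x v1 + scale y v2 + scale z v3" for x y z
  have comb_add: "comb x y z + comb x' y' z' = comb (x + x') (y + y') (z + z')" for x y z x' y' z'
    by (simp add: comb_def K.scale_left_distrib algebra_simps)
  have comb_scale: "scale l (comb x y z) = comb (l * x) (l * y) (l * z)" for l x y z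
    by (simp add: comb_def K.scale_right_distrib)
  have comb_eq: "comb x y z = comb x' y' z' \<longleftrightarrow> x = x' \<and> y = y' \<and> z = z'" for x y z x' y' z'
    using indep[of "x - x'" "y - y'" "z - z'"]
    by (auto simp: comb_def K.scale_left_diff_distrib algebra_simps)
  define el where "el = (\<lambda>(x, a, b). comb x (\<psi> x + a) (r * \<psi> (\<psi> (\<psi> (\<psi> x))) + s * a + b))"
  define D where "D = (UNIV :: 'k set) \<times> {a. \<psi> a = a} \<times> {b. \<psi> b = b}"
  define U where "U = el ` D"
  have inj_el: "inj_on el D"
    by (auto simp: inj_on_def el_def comb_eq)
  have el_add: "el (x, a, b) + el (x', a', b') = el (x + x', a + a', b + b')" for x a b x' a' b'
    by (simp add: el_def comb_add hom algebra_simps)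
  have el_scale: "scale l (el (x, a, b)) = el (l * x, l * a, l * b)" if "\<psi> l = l" for l x a b
    using that by (simp add: el_def comb_scale hom algebra_simps)
  have el_0: "el (0, 0, 0) = 0"
    by (simp add: el_def comb_def)
  have el_eq_0: "el (x, a, b) = 0 \<longleftrightarrow> x = 0 \<and> a = 0 \<and> b = 0" for x a b
    unfolding el_0[symmetric] by (auto simp: el_def comb_eq)
  have subspace: "F.subspace U"
  proof (rule F.subspaceI)
    show "0 \<in> U"
      unfolding U_def D_def by (rule image_eqI[where x = "(0, 0, 0)"]) (simp_all add: el_0)
    fix u assume u: "u \<in> U"
    then obtain x a b where u_eq: "u = el (x, a, b)" "\<psi> a = a" "\<psi> b = b"
      by (auto simp: U_def D_def)
    {
      fix v assume "v \<in> U"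
      then obtain x' a' b' where v: "v = el (x', a', b')" "\<psi> a' = a'" "\<psi> b' = b'"
        by (auto simp: U_def D_def)
      show "u + v \<in> U"
        unfolding U_def
        by (rule image_eqI[where x = "(x + x', a + a', b + b')"])
          (use u_eq v in \<open>simp_all add: el_add D_def hom\<close>)
    }
    fix c
    show "?F c u \<in> U"
      unfolding U_def
      by (rule image_eqI[where x = "(\<iota> c * x, \<iota> c * a, \<iota> c * b)"])
        (use u_eq in \<open>simp_all add: el_scale scale_F fixed_\<iota> D_def hom\<close>)
  qed
  let ?q = "card (UNIV :: 'f set)"
  have q: "?q > 1"
    using card_mono[of UNIV "{0, 1 :: 'f}"] by simp
  have "card D = ?q ^ 7"
    by (simp add: D_def card_cartesian_product card_fixed card eval_nat_numeral)
  then have card_U: "card U = ?q ^ 7"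
    using inj_el by (simp add: U_def card_image)
  have "finite U"
    by (simp add: U_def D_def)
  then have dim_U: "F.dim U = 7"
    using F.card_eq_power_dim[OF _ subspace] card_U q by simp
  \<comment> \<open>This is the core of scatteredness: nonzero vectors of \<open>U\<close> on one
    line over the large field differ only by a scalar from the small field.\<close>
  have mult: "l \<in> range \<iota>" if "w \<in> U" "w \<noteq> 0" "scale l w \<in> U" for l w
  proof -
    from that(1,3) obtain x a b y A B where
      w: "w = el (x, a, b)" "\<psi> a = a" "\<psi> b = b" and
      lw: "scale l w = el (y, A, B)" "\<psi> A = A" "\<psi> B = B"
      by (auto simp: U_def D_def)
    have eqs: "l * x = y" "l * (\<psi> x + a) = \<psi> y + A"
      "l * (r * \<psi> (\<psi> (\<psi> (\<psi> x))) + s * a + b) = r * \<psi> (\<psi> (\<psi> (\<psi> y))) + s * A + B"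
      using lw(1) unfolding w(1) by (simp_all add: el_def comb_scale comb_eq)
    have "\<psi> l = l"
      by (rule fixed_multiplier[OF w(2,3) lw(2,3), where x = x])
        (use eqs that(2) in \<open>auto simp: w(1) el_eq_0\<close>)
    then show ?thesis
      by (simp add: range)
  qed
  have dim_le: "F.dim (U \<inter> W) \<le> 1" if W: "K.subspace W" "K.dim W = 1" for W
  proof -
    obtain B where B: "B \<subseteq> W" "W \<subseteq> K.span B" "card B = K.dim W"
      using K.basis_exists[of W] by metis
    then obtain e where e: "B = {e}"
      using W(2) by (metis card_1_singletonE)
    show ?thesis
    proof (cases "U \<inter> W \<subseteq> {0}")
      case True
      then show ?thesis
        using F.dim_le_card[of "U \<inter> W" "{}"] by simp
    next
      case False
      then obtain w where w: "w \<in> U" "w \<in> W" "w \<noteq> 0"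
        by blast
      then obtain k where k: "w = scale k e"
        using B(2) by (auto simp: e K.span_singleton)
      have "U \<inter> W \<subseteq> F.span {w}"
      proof
        fix v assume v: "v \<in> U \<inter> W"
        then obtain k' where "v = scale k' e"
          using B(2) by (auto simp: e K.span_singleton)
        then have v_eq: "v = scale (k' / k) w"
          using k w(3) by auto
        with v mult[OF w(1,3)] obtain c where "k' / k = \<iota> c"
          by auto
        then have "v = ?F c w"
          by (simp add: v_eq scale_F)
        then show "v \<in> F.span {w}"
          by (simp add: F.span_scale F.span_base)
      qed
      then show ?thesis
        using F.dim_le_card[of "U \<inter> W" "{w}"] by simp
    qed
  qed
  have "?q ^ 7 > 1"
    using one_less_power[OF q, of 7] by simp
  then have "U \<noteq> {0}"
    using card_U by auto
  then have "scattered \<iota> scale U"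
    using subspace dim_le by (simp add: scattered_def)
  with dim_U show ?thesis
    by blast
qed

section \<open>Elimination\<close>

text \<open>The Sylvester resultant of two quadratics. The sort asks for operations only, so that
  both ring elements and expressions of type \<open>rexp\<close> can be inserted.\<close>

definition elim_quadratics :: "'a::{plus, minus, times} \<Rightarrow> 'a \<Rightarrow> 'a \<Rightarrow> 'a \<Rightarrow> 'a \<Rightarrow> 'a \<Rightarrow> 'a" where
  "elim_quadratics P2 P1 P0 Q2 Q1 Q0 =
     (P2 * Q0 - P0 * Q2) * (P2 * Q0 - P0 * Q2) - (P2 * Q1 - P1 * Q2) * (P1 * Q0 - P0 * Q1)"

text \<open>In an unknown \<open>d\<close>, this is the resultant of \<open>(\<alpha>1 * d +
  \<alpha>0) * (d + x) + c1 * (\<beta>1 * d + \<beta>0)\<close> and \<open>(\<gamma>1 * d +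
  \<gamma>0) * (\<beta>1 * d + \<beta>0) - l * (d + u) * (d - c0)\<close>.\<close>

definition elim_products ::
  "'a::{plus, minus, times} \<Rightarrow> 'a \<Rightarrow> 'a \<Rightarrow> 'a \<Rightarrow> 'a \<Rightarrow> 'a \<Rightarrow> 'a \<Rightarrow> 'a \<Rightarrow> 'a \<Rightarrow> 'a \<Rightarrow> 'a \<Rightarrow> 'a" where
  "elim_products x c0 c1 l u \<alpha>1 \<alpha>0 \<beta>1 \<beta>0 \<gamma>1 \<gamma>0 =
     elim_quadratics \<alpha>1 (\<alpha>1 * x + \<alpha>0 + c1 * \<beta>1) (\<alpha>0 * x + c1 * \<beta>0)
       (\<gamma>1 * \<beta>1 - l) (\<gamma>1 * \<beta>0 + \<gamma>0 * \<beta>1 - l * (u - c0)) (\<gamma>0 * \<beta>0 + l * u * c0)"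

definition resultant ::
  "'a::{plus, minus, times} \<Rightarrow> 'a \<Rightarrow> 'a \<Rightarrow> 'a \<Rightarrow> 'a \<Rightarrow> 'a \<Rightarrow> 'a \<Rightarrow> 'a \<Rightarrow> 'a \<Rightarrow> 'a \<Rightarrow> 'a \<Rightarrow> 'a" where
  "resultant a c0 c1 c2 c3 c4 e0 e1 e2 e3 e4 =
     elim_products (a - e0) c0 c1 (c2 * (c3 * c4)) (a - e4)
       ((a - e3) * (a - e1 - c4) - c3 * c4)
       ((a - e3) * (a - e1) * (a - e4))
       ((a - e3) * (a - e0 + c0 - c4) - c3 * c4)
       ((a - e3) * ((a - e4) * (a - e0 + c0) + c0 * c4) + c0 * (c3 * c4))
       (a - e2 - c4)
       ((a - e2) * (a - e4))"

text \<open>Cancelling the leading terms gives one linear equation for \<open>d\<close>; cancelling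
  the constant terms and dividing by \<open>d\<close> gives another. Up to sign, the resultant is
  the determinant of these two equations.\<close>

lemma quadratics_common_root:
  fixes d :: "'a::idom"
  assumes "P2 * d ^ 2 + P1 * d + P0 = 0" and "Q2 * d ^ 2 + Q1 * d + Q0 = 0" and "d \<noteq> 0"
  shows "elim_quadratics P2 P1 P0 Q2 Q1 Q0 = 0"
proof -
  have 1: "(P2 * Q1 - P1 * Q2) * d + (P2 * Q0 - P0 * Q2) = 0"
    using assms(1,2) by Groebner_Basis.algebra
  have "d * ((P2 * Q0 - P0 * Q2) * d + (P1 * Q0 - P0 * Q1)) = 0"
    using assms(1,2) by Groebner_Basis.algebra
  then have 2: "(P2 * Q0 - P0 * Q2) * d + (P1 * Q0 - P0 * Q1) = 0"
    using assms(3) by simp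
  from 1 2 show ?thesis
    unfolding elim_quadratics_def by Groebner_Basis.algebra
qed

text \<open>The equations \<open>h4\<close>, \<open>h3\<close> and \<open>h0\<close> are linear in
  \<open>l4\<close>, \<open>l3\<close> and \<open>l2\<close>, which become fractions in
  \<open>d = l1 - a\<close>. Then \<open>h1\<close> and \<open>h2\<close> turn into two quadratics
  for \<open>d\<close>.\<close>

lemma resultant_eq_0:
  fixes a l1 l2 l3 l4 :: "'a::idom"
  assumes h0: "(l2 - e0) * (l1 - a) = c0 * (l2 - l1)"
    and h1: "(l3 - e1) * (l2 - l1) = c1 * (l3 - l2)"
    and h2: "(l4 - e2) * (l3 - l2) = c2 * (l4 - l3)"
    and h3: "(a - e3) * (l4 - l3) = c3 * (a - l4)"
    and h4: "(l1 - e4) * (a - l4) = c4 * (l1 - a)"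
    and neq: "l1 \<noteq> a"
  shows "resultant a c0 c1 c2 c3 c4 e0 e1 e2 e3 e4 = 0"
proof -
  define d where "d = l1 - a"
  define w where "w = a - e3"
  define u where "u = a - e4"
  define v where "v = a - e0 + c0"
  define k where "k = c3 * c4"
  define \<alpha>1 where "\<alpha>1 = w * (a - e1 - c4) - k"
  define \<alpha>0 where "\<alpha>0 = w * (a - e1) * u"
  define \<beta>1 where "\<beta>1 = w * (v - c4) - k"
  define \<beta>0 where "\<beta>0 = w * (u * v + c0 * c4) + c0 * k"
  define \<gamma>1 where "\<gamma>1 = a - e2 - c4"
  define \<gamma>0 where "\<gamma>0 = (a - e2) * u"
  have l1: "l1 = a + d"
    by (simp add: d_def)
  have d: "d \<noteq> 0"
    using neq by (simp add: d_def)
  \<comment> \<open>Denominators stay multiplied out on the left, so that only the nonzero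
    \<open>d\<close> is ever cancelled.\<close>
  have x4: "(d + u) * l4 = (d + u) * a - c4 * d"
    using h4 unfolding l1 u_def by Groebner_Basis.algebra
  have x3: "w * (d + u) * (l4 - l3) = k * d"
    using h3 h4 unfolding l1 u_def w_def k_def by Groebner_Basis.algebra
  have x2: "(d - c0) * l2 = e0 * d - c0 * (a + d)"
    using h0 unfolding l1 by Groebner_Basis.algebra
  have y2: "(d - c0) * (l2 - l1) = d * (e0 - a - d)"
    using x2 unfolding l1 by Groebner_Basis.algebra
  have y3: "w * (d + u) * (l3 - e1) = \<alpha>1 * d + \<alpha>0"
    using x3 x4 unfolding \<alpha>1_def \<alpha>0_def by Groebner_Basis.algebra
  have y4: "(d + u) * (l4 - e2) = \<gamma>1 * d + \<gamma>0"
    using x4 unfolding \<gamma>1_def \<gamma>0_def by Groebner_Basis.algebra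
  have y32: "w * (d + u) * (d - c0) * (l3 - l2) = d * (\<beta>1 * d + \<beta>0)"
    using x3 x4 x2 unfolding \<beta>1_def \<beta>0_def v_def by Groebner_Basis.algebra
  have "(w * (d + u) * (l3 - e1)) * ((d - c0) * (l2 - l1)) = c1 * (w * (d + u) * (d - c0) * (l3 - l2))"
    using h1 by Groebner_Basis.algebra
  then have "d * ((\<alpha>1 * d + \<alpha>0) * (e0 - a - d)) = d * (c1 * (\<beta>1 * d + \<beta>0))"
    unfolding y3 y2 y32 by Groebner_Basis.algebra
  then have E1: "(\<alpha>1 * d + \<alpha>0) * (e0 - a - d) = c1 * (\<beta>1 * d + \<beta>0)"
    using d by simp
  have "((d + u) * (l4 - e2)) * (w * (d + u) * (d - c0) * (l3 - l2))
      = c2 * (d + u) * (d - c0) * (w * (d + u) * (l4 - l3))"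
    using h2 by Groebner_Basis.algebra
  then have "d * ((\<gamma>1 * d + \<gamma>0) * (\<beta>1 * d + \<beta>0)) = d * (c2 * (d + u) * (d - c0) * k)"
    unfolding y4 y32 x3 by Groebner_Basis.algebra
  then have E2: "(\<gamma>1 * d + \<gamma>0) * (\<beta>1 * d + \<beta>0) = c2 * (d + u) * (d - c0) * k"
    using d by simp
  have "\<alpha>1 * d ^ 2 + (\<alpha>1 * (a - e0) + \<alpha>0 + c1 * \<beta>1) * d + (\<alpha>0 * (a - e0) + c1 * \<beta>0) = 0"
    using E1 by Groebner_Basis.algebra
  moreover have "(\<gamma>1 * \<beta>1 - c2 * k) * d ^ 2 + (\<gamma>1 * \<beta>0 + \<gamma>0 * \<beta>1 - c2 * k * (u - c0)) * d
      + (\<gamma>0 * \<beta>0 + c2 * k * u * c0) = 0"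
    using E2 by Groebner_Basis.algebra
  ultimately have "elim_products (a - e0) c0 c1 (c2 * k) u \<alpha>1 \<alpha>0 \<beta>1 \<beta>0 \<gamma>1 \<gamma>0 = 0"
    using quadratics_common_root d unfolding elim_products_def by blast
  then show ?thesis
    unfolding resultant_def \<alpha>1_def \<alpha>0_def \<beta>1_def \<beta>0_def \<gamma>1_def \<gamma>0_def w_def u_def v_def k_def .
qed

text \<open>
  If \<open>c\<^sub>i y\<^sub>i\<^sub>+\<^sub>1 = (b - e\<^sub>i) y\<^sub>i\<close> cyclically, clearing denominators in \<open>\<Sum> y\<^sub>i / y\<^sub>0 = 0\<close> gives the first polynomial,
  and multiplying all five equations gives the second one.
\<close>

definition tracepoly ::
  "'a::{plus, minus, times} \<Rightarrow> 'a \<Rightarrow> 'a \<Rightarrow> 'a \<Rightarrow> 'a \<Rightarrow> 'a \<Rightarrow> 'a \<Rightarrow> 'a \<Rightarrow> 'a \<Rightarrow> 'a" where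
  "tracepoly b c0 c1 c2 c3 e0 e1 e2 e3 =
     c0 * c1 * c2 * c3 + (b - e0) * (c1 * c2 * c3 + (b - e1) * (c2 * c3 + (b - e2) * (c3 + (b - e3))))"

definition normpoly ::
  "'a::{plus, minus, times} \<Rightarrow> 'a \<Rightarrow> 'a \<Rightarrow> 'a \<Rightarrow> 'a \<Rightarrow> 'a \<Rightarrow> 'a \<Rightarrow> 'a \<Rightarrow> 'a \<Rightarrow> 'a \<Rightarrow> 'a \<Rightarrow> 'a" where
  "normpoly b c0 c1 c2 c3 c4 e0 e1 e2 e3 e4 =
     (b - e0) * (b - e1) * (b - e2) * (b - e3) * (b - e4) - c0 * c1 * c2 * c3 * c4"

lemma cyclic_chain:
  fixes y0 :: "'a::idom"
  assumes h0: "(b - e0) * y0 = c0 * y1"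
    and h1: "(b - e1) * y1 = c1 * y2"
    and h2: "(b - e2) * y2 = c2 * y3"
    and h3: "(b - e3) * y3 = c3 * y4"
    and h4: "(b - e4) * y4 = c4 * y0"
    and sum: "y0 + y1 + y2 + y3 + y4 = 0"
    and y0: "y0 \<noteq> 0"
  shows "tracepoly b c0 c1 c2 c3 e0 e1 e2 e3 = 0"
    and "normpoly b c0 c1 c2 c3 c4 e0 e1 e2 e3 e4 = 0"
proof -
  have y1: "(b - e0) * y0 = c0 * y1" by (rule h0)
  have y2: "(b - e0) * (b - e1) * y0 = c0 * c1 * y2" using h0 h1 by Groebner_Basis.algebra
  have y3: "(b - e0) * (b - e1) * (b - e2) * y0 = c0 * c1 * c2 * y3" using y2 h2 by Groebner_Basis.algebra
  have y4: "(b - e0) * (b - e1) * (b - e2) * (b - e3) * y0 = c0 * c1 * c2 * c3 * y4"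
    using y3 h3 by Groebner_Basis.algebra
  have "tracepoly b c0 c1 c2 c3 e0 e1 e2 e3 * y0 = c0 * c1 * c2 * c3 * (y0 + y1 + y2 + y3 + y4)"
    unfolding tracepoly_def using y1 y2 y3 y4 by Groebner_Basis.algebra
  then show "tracepoly b c0 c1 c2 c3 e0 e1 e2 e3 = 0"
    using sum y0 by simp
  have "normpoly b c0 c1 c2 c3 c4 e0 e1 e2 e3 e4 * y0 = 0"
    unfolding normpoly_def using y4 h4 by Groebner_Basis.algebra
  then show "normpoly b c0 c1 c2 c3 c4 e0 e1 e2 e3 e4 = 0"
    using y0 by simp
qed

section \<open>Polynomials over a quintic extension of the prime field\<close>

text \<open>Coefficients with respect to 1, g, ..., g^4, where the tuple \<open>f\<close> below
  represents g^5. Accordingly \<open>qshift\<close> is multiplication by g, and \<open>qmul\<close>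
  is a Horner scheme.\<close>

type_synonym quint = "int \<times> int \<times> int \<times> int \<times> int"

fun qval :: "'a::comm_ring_1 \<Rightarrow> quint \<Rightarrow> 'a" where
  "qval g (a0, a1, a2, a3, a4) =
     of_int a0 + g * (of_int a1 + g * (of_int a2 + g * (of_int a3 + g * of_int a4)))"

fun qadd :: "int \<Rightarrow> quint \<Rightarrow> quint \<Rightarrow> quint" where
  "qadd p (a0, a1, a2, a3, a4) (b0, b1, b2, b3, b4) =
     ((a0 + b0) mod p, (a1 + b1) mod p, (a2 + b2) mod p, (a3 + b3) mod p, (a4 + b4) mod p)"

fun qscale :: "int \<Rightarrow> int \<Rightarrow> quint \<Rightarrow> quint" where
  "qscale p c (a0, a1, a2, a3, a4) =
     (c * a0 mod p, c * a1 mod p, c * a2 mod p, c * a3 mod p, c * a4 mod p)"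

fun qshift :: "int \<Rightarrow> quint \<Rightarrow> quint \<Rightarrow> quint" where
  "qshift p f (a0, a1, a2, a3, a4) = qadd p (0, a0, a1, a2, a3) (qscale p a4 f)"

fun qmul :: "int \<Rightarrow> quint \<Rightarrow> quint \<Rightarrow> quint \<Rightarrow> quint" where
  "qmul p f (a0, a1, a2, a3, a4) b =
     qadd p (qscale p a0 b) (qshift p f (qadd p (qscale p a1 b) (qshift p f (qadd p (qscale p a2 b)
       (qshift p f (qadd p (qscale p a3 b) (qshift p f (qscale p a4 b))))))))"

fun padd :: "int \<Rightarrow> quint list \<Rightarrow> quint list \<Rightarrow> quint list" where
  "padd p [] ys = ys"
| "padd p (x # xs) [] = x # xs"
| "padd p (x # xs) (y # ys) = qadd p x y # padd p xs ys"

fun pmul :: "int \<Rightarrow> quint \<Rightarrow> quint list \<Rightarrow> quint list \<Rightarrow> quint list" where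
  "pmul p f [] ys = []"
| "pmul p f (x # xs) ys = padd p (map (qmul p f x) ys) ((0, 0, 0, 0, 0) # pmul p f xs ys)"

primrec ppow :: "int \<Rightarrow> quint \<Rightarrow> quint list \<Rightarrow> nat \<Rightarrow> quint list" where
  "ppow p f xs 0 = [(1, 0, 0, 0, 0)]"
| "ppow p f xs (Suc n) = pmul p f xs (ppow p f xs n)"

fun pval :: "'a::comm_ring_1 \<Rightarrow> 'a \<Rightarrow> quint list \<Rightarrow> 'a" where
  "pval g x [] = 0"
| "pval g x (c # cs) = qval g c + x * pval g x cs"

datatype rexp = RPoly "quint list" | RAdd rexp rexp | RSub rexp rexp | RMul rexp rexp
  | RPow rexp nat

text \<open>With these operations \<open>resultant\<close>, \<open>tracepoly\<close> and
  \<open>normpoly\<close> also produce syntax trees, which \<open>rnorm\<close> turns into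
  coefficient lists by computation.\<close>

instantiation rexp :: "{plus, minus, times, one}"
begin
definition "plus_rexp = RAdd"
definition "minus_rexp = RSub"
definition "times_rexp = RMul"
definition "one_rexp = RPoly [(1, 0, 0, 0, 0)]"
instance ..
end

primrec rval :: "'a::comm_ring_1 \<Rightarrow> 'a \<Rightarrow> rexp \<Rightarrow> 'a" where
  "rval g x (RPoly cs) = pval g x cs"
| "rval g x (RAdd s t) = rval g x s + rval g x t"
| "rval g x (RSub s t) = rval g x s - rval g x t"
| "rval g x (RMul s t) = rval g x s * rval g x t"
| "rval g x (RPow t n) = rval g x t ^ n"

lemma rval_simps [simp]:
  "rval g x (s + t) = rval g x s + rval g x t"
  "rval g x (s - t) = rval g x s - rval g x t"
  "rval g x (s * t) = rval g x s * rval g x t"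
  "rval g x 1 = 1"
  by (simp_all add: plus_rexp_def minus_rexp_def times_rexp_def one_rexp_def)

primrec rnorm :: "int \<Rightarrow> quint \<Rightarrow> rexp \<Rightarrow> quint list" where
  "rnorm p f (RPoly cs) = cs"
| "rnorm p f (RAdd s t) = padd p (rnorm p f s) (rnorm p f t)"
| "rnorm p f (RSub s t) = padd p (rnorm p f s) (map (qscale p (-1)) (rnorm p f t))"
| "rnorm p f (RMul s t) = pmul p f (rnorm p f s) (rnorm p f t)"
| "rnorm p f (RPow t n) = ppow p f (rnorm p f t) n"

definition rzero :: "int \<Rightarrow> quint \<Rightarrow> rexp \<Rightarrow> bool" where
  "rzero p f t \<longleftrightarrow> list_all (\<lambda>c. c = (0, 0, 0, 0, 0)) (rnorm p f t)"

context
  fixes p :: int and f :: quint and g :: "'a::comm_ring_1"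
  assumes p: "of_int p = (0 :: 'a)" and f: "g ^ 5 = qval g f"
begin

lemma of_int_mod: "of_int (a mod p) = (of_int a :: 'a)"
proof -
  have "(of_int a :: 'a) = of_int (p * (a div p) + a mod p)"
    by simp
  then show ?thesis
    by (simp only: of_int_add of_int_mult p) simp
qed

lemma qval_qadd: "qval g (qadd p a b) = qval g a + qval g b"
  by (cases a; cases b) (simp add: of_int_mod algebra_simps)

lemma qval_qscale: "qval g (qscale p c a) = of_int c * qval g a"
  by (cases a) (simp add: of_int_mod algebra_simps)

lemma qval_qshift: "qval g (qshift p f a) = g * qval g a"
proof -
  obtain a0 a1 a2 a3 a4 where a: "a = (a0, a1, a2, a3, a4)"
    by (cases a)
  have "qval g (qshift p f a) = qval g (0, a0, a1, a2, a3) + of_int a4 * g ^ 5"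
    unfolding a by (simp only: qshift.simps qval_qadd qval_qscale f)
  then show ?thesis
    unfolding a by (simp add: algebra_simps eval_nat_numeral)
qed

lemma qval_qmul: "qval g (qmul p f a b) = qval g a * qval g b"
  by (cases a) (simp add: qval_qadd qval_qscale qval_qshift algebra_simps)

lemma pval_padd: "pval g x (padd p xs ys) = pval g x xs + pval g x ys"
  by (induction xs ys rule: list_induct2') (simp_all add: qval_qadd algebra_simps)

lemma pval_map_qmul: "pval g x (map (qmul p f c) xs) = qval g c * pval g x xs"
  by (induction xs) (simp_all add: qval_qmul algebra_simps)

lemma pval_map_qscale: "pval g x (map (qscale p c) xs) = of_int c * pval g x xs"
  by (induction xs) (simp_all add: qval_qscale algebra_simps)

lemma pval_pmul: "pval g x (pmul p f xs ys) = pval g x xs * pval g x ys"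
  by (induction xs) (simp_all add: pval_padd pval_map_qmul algebra_simps)

lemma pval_ppow: "pval g x (ppow p f xs n) = pval g x xs ^ n"
  by (induction n) (simp_all add: pval_pmul)

lemma pval_rnorm: "pval g x (rnorm p f t) = rval g x t"
  by (induction t) (simp_all add: pval_padd pval_pmul pval_ppow pval_map_qscale)

text \<open>Normalisation preserves values wherever \<open>p\<close> vanishes and
  \<open>g ^ 5\<close> has the prescribed value, so one computation serves both the field and its
  algebraic closure.\<close>

lemma rval_eq_0: "rzero p f t \<Longrightarrow> rval g x t = 0"
proof -
  have "pval g x cs = 0" if "list_all (\<lambda>c. c = (0, 0, 0, 0, 0)) cs" for cs
    using that by (induction cs) auto
  then show "rzero p f t \<Longrightarrow> rval g x t = 0"
    unfolding rzero_def by (simp flip: pval_rnorm)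
qed

end

section \<open>Certificates\<close>

abbreviation (input) rvar :: rexp where "rvar \<equiv> RPoly [(0, 0, 0, 0, 0), (1, 0, 0, 0, 0)]"
abbreviation (input) rconst :: "quint \<Rightarrow> rexp" where "rconst c \<equiv> RPoly [c]"

lemma rval_elim_quadratics:
  "rval g x (elim_quadratics P2 P1 P0 Q2 Q1 Q0) =
    elim_quadratics (rval g x P2) (rval g x P1) (rval g x P0) (rval g x Q2) (rval g x Q1) (rval g x Q0)"
  by (simp only: elim_quadratics_def rval_simps)

lemma rval_elim_products:
  "rval g x (elim_products y c0 c1 l u a1 a0 b1 b0 d1 d0) =
    elim_products (rval g x y) (rval g x c0) (rval g x c1) (rval g x l) (rval g x u)
      (rval g x a1) (rval g x a0) (rval g x b1) (rval g x b0) (rval g x d1) (rval g x d0)"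
  by (simp only: elim_products_def rval_elim_quadratics rval_simps)

lemma rval_resultant [simp]:
  "rval g x (resultant a c0 c1 c2 c3 c4 e0 e1 e2 e3 e4) =
    resultant (rval g x a) (rval g x c0) (rval g x c1) (rval g x c2) (rval g x c3) (rval g x c4)
      (rval g x e0) (rval g x e1) (rval g x e2) (rval g x e3) (rval g x e4)"
  by (simp only: resultant_def rval_elim_products rval_simps)

lemma rval_tracepoly [simp]:
  "rval g x (tracepoly b c0 c1 c2 c3 e0 e1 e2 e3) =
    tracepoly (rval g x b) (rval g x c0) (rval g x c1) (rval g x c2) (rval g x c3)
      (rval g x e0) (rval g x e1) (rval g x e2) (rval g x e3)"
  by (simp only: tracepoly_def rval_simps)

lemma rval_normpoly [simp]:
  "rval g x (normpoly b c0 c1 c2 c3 c4 e0 e1 e2 e3 e4) =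
    normpoly (rval g x b) (rval g x c0) (rval g x c1) (rval g x c2) (rval g x c3) (rval g x c4)
      (rval g x e0) (rval g x e1) (rval g x e2) (rval g x e3) (rval g x e4)"
  by (simp only: normpoly_def rval_simps)

definition frobenius_step :: "nat \<Rightarrow> quint \<Rightarrow> quint \<Rightarrow> quint \<Rightarrow> bool" where
  "frobenius_step p f c d \<longleftrightarrow> rzero (int p) f (RPow (rconst c) p - rconst d)"

definition frobenius5 :: "nat \<Rightarrow> quint \<Rightarrow> quint \<Rightarrow> bool" where
  "frobenius5 p f c \<longleftrightarrow> rzero (int p) f (RPow (RPow (RPow (RPow (RPow (rconst c) p) p) p) p) p - rconst c)"

text \<open>The tested equation is the one with coefficients \<open>c0\<close> and \<open>e0\<close>
  in the cyclic system; the \<open>p\<close>-th powers stand for applications of \<psi>.\<close>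

definition nonsolution :: "nat \<Rightarrow> quint \<Rightarrow> quint \<Rightarrow> quint \<Rightarrow> quint \<Rightarrow> quint \<Rightarrow> bool" where
  "nonsolution p f c e l i \<longleftrightarrow> frobenius5 p f l \<and>
     rzero (int p) f
       (((RPow (RPow (rconst l) p) p - rconst e) * (RPow (rconst l) p - rconst l)
          - rconst c * (RPow (RPow (rconst l) p) p - RPow (rconst l) p)) * rconst i - 1)"

definition cubic_reduction ::
  "nat \<Rightarrow> quint \<Rightarrow> int \<Rightarrow> int \<Rightarrow> quint list \<Rightarrow> quint list \<Rightarrow> quint list \<Rightarrow> bool" where
  "cubic_reduction p f u v C \<tau> Q \<longleftrightarrow>
     rzero (int p) f (RPow (RPoly \<tau>) 3 + rconst (u, 0, 0, 0, 0) * RPoly \<tau> + rconst (v, 0, 0, 0, 0) - RPoly C * RPoly Q)"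

text \<open>
  The data of a certificate were found by a computer search. The \<open>c\<close> and \<open>e\<close> are the conjugates of
  \<open>c0\<close> and \<open>e0\<close>, and \<open>c3\<close> and \<open>e3\<close> are the coefficients \<open>r\<close> and \<open>s\<close>. The linear factors of the resultant
  have the roots \<open>l1\<close> and \<open>l2\<close>, and \<open>i1\<close>, \<open>i2\<close> are inverses that show that these roots do not solve the
  system. The polynomial \<open>\<tau>\<close> sends every root of the cubic factor \<open>C\<close> to a root of \<open>t\<^sup>3 + u t + v\<close>, which is
  irreducible over the prime field.
\<close>

locale certificate =
  fixes p :: nat and f c0 c1 c2 c3 c4 e0 e1 e2 e3 e4 l1 i1 l2 i2 :: quint and u v :: int
    and C1 \<tau>1 Q1 C2 \<tau>2 Q2 \<alpha> \<beta> :: "quint list"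
  assumes generator: "frobenius5 p f (0, 1, 0, 0, 0)"
    and c_cycle: "frobenius_step p f c0 c1" "frobenius_step p f c1 c2" "frobenius_step p f c2 c3"
      "frobenius_step p f c3 c4" "frobenius_step p f c4 c0"
    and e_cycle: "frobenius_step p f e0 e1" "frobenius_step p f e1 e2" "frobenius_step p f e2 e3"
      "frobenius_step p f e3 e4" "frobenius_step p f e4 e0"
    and linear: "nonsolution p f c0 e0 l1 i1" "nonsolution p f c0 e0 l2 i2"
    and cubic: "cubic_reduction p f u v C1 \<tau>1 Q1" "cubic_reduction p f u v C2 \<tau>2 Q2"
    and resultant: "rzero (int p) f
      (resultant rvar (rconst c0) (rconst c1) (rconst c2) (rconst c3) (rconst c4)
         (rconst e0) (rconst e1) (rconst e2) (rconst e3) (rconst e4)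
       - (rvar - rconst l1) * (rvar - rconst l2) * RPoly C1 * RPoly C2)"
    and bezout: "rzero (int p) f
      (RPoly \<alpha> * tracepoly rvar (rconst c0) (rconst c1) (rconst c2) (rconst c3)
         (rconst e0) (rconst e1) (rconst e2) (rconst e3)
       + RPoly \<beta> * normpoly rvar (rconst c0) (rconst c1) (rconst c2) (rconst c3) (rconst c4)
         (rconst e0) (rconst e1) (rconst e2) (rconst e3) (rconst e4) - 1)"

context certificate
begin

section \<open>From a certificate to suitable coefficients\<close>

text \<open>The quintic has a root in the algebraic closure. By \<open>generator\<close> that root
  is fixed by the power \<open>p ^ 5\<close>, and since 5 divides \<open>n\<close> it lies in the
  finite field itself.\<close>

lemma ex_generator:
  assumes p: "prime p" and card: "card (UNIV :: 'k::{field,finite} set) = p ^ n" and n: "5 dvd n"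
  obtains g :: "'k::{field,finite}" where "g ^ 5 = qval g f"
proof -
  have char: "CHAR('k) = p"
    by (rule CHAR_eq_prime[OF p card])
  obtain a0 a1 a2 a3 a4 where f: "f = (a0, a1, a2, a3, a4)"
    by (cases f)
  define F :: "nat \<Rightarrow> 'k alg_closure"
    where "F k = [- of_int a0, - of_int a1, - of_int a2, - of_int a3, - of_int a4, 1] ! k" for k
  obtain h where "(\<Sum>k\<le>Suc (Suc (Suc (Suc (Suc 0)))). F k * h ^ k) = 0"
    using alg_closed[of "Suc (Suc (Suc (Suc (Suc 0))))" F] by (auto simp: F_def)
  then have h: "h ^ 5 = qval h f"
    by (simp add: F_def f eval_nat_numeral algebra_simps)
  have "of_int (int p) = (0 :: 'k alg_closure)"
    using of_nat_CHAR[where ?'a = "'k alg_closure"] by (simp add: char)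
  \<comment> \<open>The expression is constant, so 0 is merely a dummy value for the polynomial
    variable.\<close>
  from rval_eq_0[OF this h generator[unfolded frobenius5_def], of 0]
  have "h ^ (p ^ 5) = h"
    by (simp add: eval_nat_numeral mult.assoc flip: power_mult)
  then have "h ^ card (UNIV :: 'k set) = h"
    using power_prime_power_iterate[of h p 5] n by (auto simp: card)
  then obtain g where g: "h = to_ac g"
    by (rule alg_closure_power_fixed)
  have "qval (to_ac g) c = to_ac (qval g c)" for c
    by (cases c) simp
  with h have "to_ac (g ^ 5) = to_ac (qval g f)"
    by (simp add: g)
  then show thesis
    using that by (simp only: to_ac_eq_iff)
qed

lemma ex_scattered_coeffs:
  fixes \<psi> :: "'k::{field,finite} \<Rightarrow> 'k"
  assumes p: "prime p" and card: "card (UNIV :: 'k set) = p ^ n" and n: "5 dvd n" "n dvd 5 * M"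
    and \<psi>_def: "\<psi> = (\<lambda>x. x ^ (p ^ M))" and M: "M mod 5 = 1"
    and no_root: "\<And>t :: 'k. t ^ 3 + of_int u * t + of_int v \<noteq> 0"
  shows "\<exists>r s. scattered_coeffs \<psi> r s"
proof -
  have char: "CHAR('k) = p"
    by (rule CHAR_eq_prime[OF p card])
  interpret order5_aut \<psi>
  proof
    show "\<psi> (x + y) = \<psi> x + \<psi> y" for x y
      unfolding \<psi>_def by (rule freshmans_dream') (simp_all add: char p)
    show "\<psi> (x * y) = \<psi> x * \<psi> y" for x y
      by (simp add: \<psi>_def power_mult_distrib)
    fix x :: 'k
    have "x ^ (p ^ n) = x"
      using power_card_eq_self[of x] by (simp add: card)
    then have "x ^ (p ^ (5 * M)) = x"
      using power_prime_power_iterate n(2) by (metis dvdE)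
    then show "\<psi> (\<psi> (\<psi> (\<psi> (\<psi> x)))) = x"
      by (simp add: \<psi>_def add.assoc numeral_eq_Suc flip: power_mult power_add)
  qed
  obtain k where k: "M = 5 * k + 1"
    using M by (metis mult_div_mod_eq)
  \<comment> \<open>As \<open>M\<close> is 1 modulo 5, \<psi> acts as the \<open>p\<close>-th power
    on such elements.\<close>
  have \<psi>_eq: "\<psi> z = z ^ p" if "z ^ (p ^ 5) = z" for z
  proof -
    have "\<psi> z = (z ^ (p ^ (5 * k))) ^ p"
      by (simp add: \<psi>_def k power_add mult.commute flip: power_mult)
    then show ?thesis
      by (simp add: power_prime_power_iterate that)
  qed
  obtain g :: 'k where g: "g ^ 5 = qval g f"
    by (rule ex_generator[OF p card n(1)])
  have p0: "of_int (int p) = (0 :: 'k)"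
    using of_nat_CHAR[where ?'a = 'k] by (simp add: char)
  have check: "rzero (int p) f t \<Longrightarrow> rval g x t = 0" for t x
    by (rule rval_eq_0[OF p0 g])
  have step: "frobenius_step p f c d \<Longrightarrow> qval g c ^ p = qval g d" for c d
    unfolding frobenius_step_def by (drule check[where x = 0]) simp
  \<comment> \<open>Going once round the cycle shows that the element is fixed by the power
    \<open>p ^ 5\<close>, so \<psi> sends it to its \<open>p\<close>-th power.\<close>
  have cycle: "\<psi> (qval g c) = qval g d"
    if "frobenius_step p f c d" "frobenius_step p f d d'" "frobenius_step p f d' d''"
      "frobenius_step p f d'' d'''" "frobenius_step p f d''' c" for c d d' d'' d'''
  proof -
    have "qval g c ^ (p ^ 5) = ((((qval g c ^ p) ^ p) ^ p) ^ p) ^ p"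
      by (simp add: eval_nat_numeral mult.assoc flip: power_mult)
    also have "\<dots> = qval g c"
      by (simp only: that[THEN step])
    finally show ?thesis
      using \<psi>_eq step[OF that(1)] by simp
  qed
  let ?c0 = "qval g c0" and ?c1 = "qval g c1" and ?c2 = "qval g c2" and ?c3 = "qval g c3"
    and ?c4 = "qval g c4"
  let ?e0 = "qval g e0" and ?e1 = "qval g e1" and ?e2 = "qval g e2" and ?e3 = "qval g e3"
    and ?e4 = "qval g e4"
  have \<psi>c: "\<psi> ?c0 = ?c1" "\<psi> ?c1 = ?c2" "\<psi> ?c2 = ?c3" "\<psi> ?c3 = ?c4" "\<psi> ?c4 = ?c0"
    by (rule cycle; fact c_cycle)+
  have \<psi>e: "\<psi> ?e0 = ?e1" "\<psi> ?e1 = ?e2" "\<psi> ?e2 = ?e3" "\<psi> ?e3 = ?e4" "\<psi> ?e4 = ?e0"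
    by (rule cycle; fact e_cycle)+
  note \<psi>_const = \<psi>c \<psi>e
  have not_linear: "(\<psi> (\<psi> l) - ?e0) * (\<psi> l - l) \<noteq> ?c0 * (\<psi> (\<psi> l) - \<psi> l)"
    if "nonsolution p f c0 e0 l' i" "l = qval g l'" for l l' i
  proof -
    note nonsol = conjunct1[OF that(1)[unfolded nonsolution_def]]
      conjunct2[OF that(1)[unfolded nonsolution_def]]
    have "l ^ (p ^ 5) = l"
      using check[OF nonsol(1)[unfolded frobenius5_def], of 0]
      by (simp add: that(2) eval_nat_numeral mult.assoc flip: power_mult)
    moreover from this have "(l ^ p) ^ (p ^ 5) = l ^ p"
      by (metis mult.commute power_mult)
    ultimately have \<psi>l: "\<psi> l = l ^ p" "\<psi> (l ^ p) = (l ^ p) ^ p"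
      by (simp_all only: \<psi>_eq)
    have "((\<psi> (\<psi> l) - ?e0) * (\<psi> l - l) - ?c0 * (\<psi> (\<psi> l) - \<psi> l)) * qval g i - 1 = 0"
      using check[OF nonsol(2), of 0] unfolding \<psi>l that(2)[symmetric] by (simp add: that(2))
    then show ?thesis
      by auto
  qed
  have not_cubic: "pval g x C \<noteq> 0" if "cubic_reduction p f u v C \<tau> Q" for x C \<tau> Q
  proof
    assume "pval g x C = 0"
    with check[OF that[unfolded cubic_reduction_def], of x]
    have "pval g x \<tau> ^ 3 + of_int u * pval g x \<tau> + of_int v = 0"
      by simp
    with no_root show False
      by blast
  qed
  have "scattered_coeffs \<psi> ?c3 ?e3"
  proof unfold_locales
    fix x b c assume x: "\<psi> x \<noteq> x" and b: "\<psi> b = b" and c: "\<psi> c = c"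
    show "(b * x - c - ?e3) * (\<psi> (\<psi> (\<psi> x)) - \<psi> (\<psi> (\<psi> (\<psi> x)))) \<noteq> ?c3 * (\<psi> (\<psi> (\<psi> (\<psi> x))) - x)"
    proof
      assume eq: "(b * x - c - ?e3) * (\<psi> (\<psi> (\<psi> x)) - \<psi> (\<psi> (\<psi> (\<psi> x))))
        = ?c3 * (\<psi> (\<psi> (\<psi> (\<psi> x))) - x)"
      show False
      proof (cases "b = 0")
        case True
        \<comment> \<open>For \<open>b = 0\<close> the equation links two consecutive conjugates of
          \<open>y\<close>, and the sum of all five conjugates telescopes to 0.\<close>
        define y where "y = \<psi> x - x"
        have y3: "(- c - ?e3) * \<psi> (\<psi> (\<psi> y)) = ?c3 * \<psi> (\<psi> (\<psi> (\<psi> y)))"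
          using eq True by (simp add: y_def hom order5 algebra_simps)
        note y4 = arg_cong[OF y3, of \<psi>, unfolded hom \<psi>_const c order5]
        note y0 = arg_cong[OF y4, of \<psi>, unfolded hom \<psi>_const c order5]
        note y1 = arg_cong[OF y0, of \<psi>, unfolded hom \<psi>_const c order5]
        note y2 = arg_cong[OF y1, of \<psi>, unfolded hom \<psi>_const c order5]
        have "y + \<psi> y + \<psi> (\<psi> y) + \<psi> (\<psi> (\<psi> y)) + \<psi> (\<psi> (\<psi> (\<psi> y))) = 0"
          by (simp add: y_def hom order5)
        note chain = cyclic_chain[OF y0 y1 y2 y3 y4 this]
        show False
          using check[OF bezout, of "- c"] chain x by (simp add: y_def)
      next
        case False
        define a where "a = b * x - c"
        have a: "\<psi> a \<noteq> a"
          using x False by (simp add: a_def hom b c)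
        have "(a - ?e3) * (b * (\<psi> (\<psi> (\<psi> x)) - \<psi> (\<psi> (\<psi> (\<psi> x))))) = ?c3 * (b * (\<psi> (\<psi> (\<psi> (\<psi> x))) - x))"
          using eq by (simp add: a_def)
        then have a3: "(a - ?e3) * (\<psi> (\<psi> (\<psi> (\<psi> a))) - \<psi> (\<psi> (\<psi> a))) = ?c3 * (a - \<psi> (\<psi> (\<psi> (\<psi> a))))"
          by (simp add: a_def hom b c algebra_simps)
        \<comment> \<open>Applying \<psi> permutes the coefficients cyclically; each of the five
          equations is numbered after its coefficients.\<close>
        note a4 = arg_cong[OF a3, of \<psi>, unfolded hom \<psi>_const order5]
        note a0 = arg_cong[OF a4, of \<psi>, unfolded hom \<psi>_const order5]
        note a1 = arg_cong[OF a0, of \<psi>, unfolded hom \<psi>_const order5]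
        note a2 = arg_cong[OF a1, of \<psi>, unfolded hom \<psi>_const order5]
        have "(a - qval g l1) * (a - qval g l2) * pval g a C1 * pval g a C2 = 0"
          using check[OF resultant, of a] resultant_eq_0[OF a0 a1 a2 a3 a4 a] by simp
        then consider "a = qval g l1" | "a = qval g l2"
          using not_cubic[OF cubic(1)] not_cubic[OF cubic(2)] by auto
        then show False
          using not_linear[OF linear(1)] not_linear[OF linear(2)] a0 by cases auto
      qed
    qed
  qed
  then show ?thesis
    by blast
qed

end

section \<open>The certificates in characteristic 2, 3 and 5\<close>

text \<open>Here g^5 = g^2 + 1, r = 1 + g^3 and s = g^8. In all three certificates \<open>C2\<close>
  carries the leading coefficient of the resultant.\<close>

lemma certificate_2: "certificate 2 (1, 0, 1, 0, 0)
    (1, 1, 1, 1, 0) (1, 1, 1, 1, 1) (0, 1, 0, 0, 1) (1, 0, 0, 1, 0) (1, 1, 0, 1, 0)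
    (0, 1, 0, 0, 0) (0, 0, 1, 0, 0) (0, 0, 0, 0, 1) (1, 0, 1, 1, 0) (1, 1, 0, 1, 1)
    (1, 0, 1, 1, 0) (1, 0, 1, 1, 1) (0, 0, 1, 0, 0) (1, 0, 0, 0, 1)
    1 1
    [(1, 1, 0, 0, 0), (1, 1, 0, 0, 0), (1, 1, 1, 1, 0), (1, 0, 0, 0, 0)]
    [(0, 1, 1, 0, 0), (1, 0, 1, 0, 0), (0, 0, 1, 1, 0)]
    [(1, 1, 0, 0, 1), (1, 0, 0, 1, 0), (1, 0, 1, 0, 0), (1, 0, 0, 1, 0)]
    [(0, 0, 0, 1, 0), (0, 0, 0, 1, 0), (1, 0, 1, 1, 0), (1, 1, 0, 1, 1)]
    [(0, 0, 1, 0, 1), (0, 0, 0, 1, 0), (0, 0, 0, 1, 0)]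
    [(1, 0, 1, 0, 0), (1, 0, 0, 1, 1), (1, 0, 1, 0, 0), (0, 1, 1, 1, 1)]
    [(1, 0, 1, 0, 0), (0, 1, 1, 1, 1), (1, 0, 0, 0, 0), (0, 0, 0, 1, 1), (1, 1, 1, 0, 1)]
    [(0, 0, 1, 1, 0), (1, 0, 0, 0, 1), (1, 0, 0, 0, 0), (1, 1, 1, 0, 1)]"
  by unfold_locales code_simp+

text \<open>Here g is a primitive 11th root of unity with conjugates g, g^3, g^9, g^5, g^4; r = g^5
  and s = 0.\<close>

lemma certificate_3: "certificate 3 (1, 0, 2, 1, 2)
    (0, 1, 0, 0, 0) (0, 0, 0, 1, 0) (1, 2, 1, 1, 0) (1, 0, 2, 1, 2) (0, 0, 0, 0, 1)
    (0, 0, 0, 0, 0) (0, 0, 0, 0, 0) (0, 0, 0, 0, 0) (0, 0, 0, 0, 0) (0, 0, 0, 0, 0)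
    (2, 0, 1, 2, 1) (1, 1, 0, 0, 1) (0, 2, 0, 0, 0) (0, 0, 2, 2, 0)
    2 2
    [(0, 0, 2, 0, 0), (2, 2, 2, 1, 0), (2, 2, 2, 0, 1), (1, 0, 0, 0, 0)]
    [(0, 1, 2, 0, 1), (2, 2, 0, 0, 2), (1, 1, 2, 2, 1)]
    [(0, 1, 2, 1, 1), (0, 1, 2, 1, 0), (0, 2, 0, 2, 2), (1, 1, 1, 2, 1)]
    [(0, 1, 1, 0, 1), (0, 1, 1, 1, 1), (1, 1, 1, 1, 1), (0, 1, 0, 1, 1)]
    [(2, 1, 1, 2, 2), (0, 2, 2, 0, 0), (2, 1, 2, 1, 0)]
    [(2, 0, 2, 1, 1), (0, 0, 1, 0, 2), (2, 2, 0, 2, 2), (0, 1, 1, 0, 0)]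
    [(2, 0, 1, 0, 1), (2, 2, 2, 0, 1), (2, 1, 0, 0, 0), (1, 0, 1, 0, 2), (1, 1, 1, 2, 2)]
    [(2, 0, 2, 1, 1), (2, 2, 1, 2, 0), (0, 1, 1, 0, 2), (2, 2, 2, 1, 1)]"
  by unfold_locales code_simp+

text \<open>Here g^5 = g + 1, so the Frobenius map shifts g by 1; r = 1 and s = -(g + 3)^2.\<close>

lemma certificate_5: "certificate 5 (1, 1, 0, 0, 0)
    (1, 0, 0, 0, 0) (1, 0, 0, 0, 0) (1, 0, 0, 0, 0) (1, 0, 0, 0, 0) (1, 0, 0, 0, 0)
    (0, 0, 4, 0, 0) (4, 3, 4, 0, 0) (1, 1, 4, 0, 0) (1, 4, 4, 0, 0) (4, 2, 4, 0, 0)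
    (0, 4, 4, 0, 0) (0, 4, 4, 4, 4) (4, 0, 4, 0, 0) (2, 3, 4, 4, 3)
    1 1
    [(4, 0, 0, 0, 2), (4, 4, 4, 3, 2), (2, 4, 0, 3, 0), (1, 0, 0, 0, 0)]
    [(1, 1, 0, 0, 2), (4, 2, 0, 0, 2), (1, 0, 4, 2, 2)]
    [(0, 1, 4, 4, 0), (2, 0, 0, 0, 1), (4, 1, 4, 2, 1), (0, 4, 4, 2, 2)]
    [(0, 3, 4, 0, 1), (3, 0, 1, 4, 1), (1, 1, 2, 3, 0), (3, 4, 2, 1, 4)]
    [(0, 4, 4, 2, 4), (3, 3, 1, 2, 0), (1, 2, 4, 2, 4)]
    [(3, 1, 4, 3, 1), (0, 3, 4, 3, 1), (3, 1, 2, 4, 3), (2, 1, 3, 2, 4)]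
    [(3, 4, 4, 3, 4), (4, 4, 1, 4, 0), (2, 2, 0, 1, 0), (4, 1, 0, 3, 0), (4, 0, 0, 3, 0)]
    [(2, 4, 2, 0, 0), (1, 0, 0, 2, 4), (4, 4, 4, 2, 4), (1, 0, 0, 2, 0)]"
  by unfold_locales code_simp+

theorem theorem5p1:
  fixes p h q :: nat and s :: int
    and \<iota> :: "'f::{field,finite} \<Rightarrow> 'k::{field,finite}"
    and scale :: "'k \<Rightarrow> 'v::ab_group_add \<Rightarrow> 'v"
  assumes "prime p" and "p \<in> {2, 3, 5}"
    and "p \<in> {2, 3} \<Longrightarrow> gcd s 15 = 1"
    and "p = 5 \<Longrightarrow> s = 1"
    and "15 * int h + s > 0"
    and "q = p ^ nat (15 * int h + s)"
    and "card (UNIV :: 'f set) = q"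
    and "card (UNIV :: 'k set) = q ^ 5"
    and "field_embedding \<iota>"
    and "vector_space scale"
    and "vector_space.dim scale UNIV = 3"
  shows "\<exists>U. scattered \<iota> scale U \<and> vector_space.dim (restrict_scalars \<iota> scale) U = 7"
proof -
  define m where "m = nat (15 * int h + s)"
  have m: "int m = 15 * int h + s" "m > 0"
    using assms(5) by (simp_all add: m_def)
  have "gcd s 15 = 1"
    using assms(2-4) by auto
  then have s: "coprime s 15"
    by (simp add: coprime_iff_gcd_eq_1)
  have coprime: "coprime (int m) 15"
  proof (rule coprimeI)
    fix d assume d: "d dvd int m" "d dvd 15"
    then have "d dvd int m - 15 * int h"
      by simp
    then show "is_unit d"
      using s d(2) m(1) by (intro coprime_common_divisor[of s 15]) simp_all
  qed
  have not_3: "\<not> 3 dvd m * 5"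
  proof
    assume "3 dvd m * 5"
    then have "3 dvd m"
      by presburger
    then have "int 3 dvd int m"
      by (simp only: int_dvd_int_iff)
    then show False
      using coprime_common_divisor[OF coprime, of 3] by simp
  qed
  have "coprime (int m) (int 5)"
    using coprime_divisors[OF dvd_refl _ coprime, of 5] by simp
  then have "coprime m 5"
    by (simp only: coprime_int_iff)
  then have m5: "gcd m 5 = 1"
    by (rule coprime_imp_gcd_eq_1)
  \<comment> \<open>\<open>k\<close> is an inverse of \<open>m\<close> modulo 5. It makes \<psi>,
    the power \<open>q ^ k\<close>, act on the field of order p^5 as the Frobenius map.\<close>
  obtain k y where k: "m * k = 5 * y + 1"
    using bezout_nat[of m 5] m(2) m5 by auto
  have k5: "gcd k 5 = 1"
  proof -
    have "gcd k 5 dvd m * k - 5 * y"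
      by (intro dvd_diff_nat) simp_all
    then show ?thesis
      by (simp add: k)
  qed
  have card_f: "card (UNIV :: 'f set) = p ^ m" and card_k: "card (UNIV :: 'k set) = p ^ (m * 5)"
    using assms(6-8) by (simp_all add: m_def power_mult)
  have fixed: "x ^ (p ^ (m * 5)) = x" for x :: 'k
    using power_card_eq_self[of x] by (simp only: card_k)
  define \<psi> where "\<psi> = (\<lambda>x :: 'k. x ^ (p ^ (m * k)))"
  have \<psi>_fixed: "\<psi> x = x \<longleftrightarrow> x ^ (p ^ m) = x" for x
  proof
    assume "\<psi> x = x"
    \<comment> \<open>As \<open>k\<close> is prime to 5, the gcd equals \<open>m\<close>, so \<psi>
      fixes nothing beyond the field of order q.\<close>
    then have "x ^ (p ^ gcd (m * k) (m * 5)) = x"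
      using fixed unfolding \<psi>_def by (rule power_prime_power_gcd)
    then show "x ^ (p ^ m) = x"
      by (simp add: gcd_mult_distrib_nat[symmetric] k5)
  qed (simp add: \<psi>_def power_prime_power_iterate)
  have emb: "\<iota> 1 = 1" "\<iota> (x + y) = \<iota> x + \<iota> y" "\<iota> (x * y) = \<iota> x * \<iota> y" for x y
    using assms(9) by (auto simp: field_embedding_def)
  have "range \<iota> = {x. x ^ card (UNIV :: 'f set) = x}"
  proof (rule range_eq_power_fixed)
    show "inj \<iota>"
      by (rule inj_field_embedding[OF assms(9)])
    show "\<iota> (x ^ n) = \<iota> x ^ n" for x n
      by (induction n) (simp_all add: emb)
  qed
  then have range: "range \<iota> = {x. \<psi> x = x}"
    by (simp add: \<psi>_fixed card_f)
  have "\<exists>r t. scattered_coeffs \<psi> r t"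
  proof -
    have "m * 5 dvd m * (5 * k)"
      by simp
    then have M: "5 dvd m * 5" "m * 5 dvd 5 * (m * k)" "m * k mod 5 = 1"
      by (simp_all only: mult.left_commute) (simp_all add: k)
    consider "p = 2" | "p = 3" | "p = 5"
      using assms(2) by auto
    then show ?thesis
    proof cases
      case 1
      show ?thesis
        by (rule certificate.ex_scattered_coeffs[OF certificate_2 _ _ M(1,2) _ M(3)])
          (use 1 card_k not_3 no_root_2[OF _ not_3] in \<open>simp_all add: \<psi>_def\<close>)
    next
      case 2
      show ?thesis
        by (rule certificate.ex_scattered_coeffs[OF certificate_3 _ _ M(1,2) _ M(3)])
          (use 2 card_k not_3 no_root_3[OF _ not_3] in \<open>simp_all add: \<psi>_def\<close>)
    next
      case 3
      show ?thesis
        by (rule certificate.ex_scattered_coeffs[OF certificate_5 _ _ M(1,2) _ M(3)])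
          (use 3 card_k not_3 no_root_5[OF _ not_3] in \<open>simp_all add: \<psi>_def\<close>)
    qed
  qed
  then obtain r t where "scattered_coeffs \<psi> r t"
    by blast
  then show ?thesis
    using ex_scattered_dim_7[OF assms(9-11) _ range] assms(7,8) by simp
qed

end
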